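(* Consider the system $\dot{\mathbf{x}}=\mathbf{f}(\mathbf{x})$ with $\mathbf{f}\colon\mathbb{R}^n\to\mathbb{R}^n$ a polynomial vector field, an initial set $\mathcal{X}_0\subseteq\mathbb{R}^n$ and an unsafe set $\mathcal{X}_u\subseteq\mathbb{R}^n$. Let $B\in\mathbb{R}[\mathbf{x}]$ and $\Psi=\{\mathbf{x}\mid B(\mathbf{x})\le 0\}$. (1) If $B$ is an invariant barrier certificate of the system (w.r.t. $\mathcal{X}_0,\mathcal{X}_u$), then $\Psi$ is an inductive invariant of the system. (2) Conversely, if $\Psi$ is an inductive invariant of the system satisfying $\mathcal{X}_0\subseteq\Psi$ and $\Psi\cap\mathcal{X}_u=\emptyset$, then $B$ is an invariant barrier certificate of the system.
   Context: For each $\mathbf{x}_0\in\mathbb{R}^n$, $\boldsymbol{\zeta}_{\mathbf{x}_0}\colon[0,T)\to\mathbb{R}^n$ denotes the unique solution of $\dot{\mathbf{x}}=\mathbf{f}(\mathbf{x})$ with $\boldsymbol{\zeta}_{\mathbf{x}_0}(0)=\mathbf{x}_0$, where $T\in\mathbb{R}^+\cup\{\infty\}$ is the maximal existence time. A set $\Psi\subseteq\mathbb{R}^n$ is an inductive invariant iff for all $\mathbf{x}_0\in\Psi$ and all $t\in[0,T)$, $\boldsymbol{\zeta}_{\mathbf{x}_0}(t)\in\Psi$. Lie derivatives: $\mathcal{L}_{\mathbf{f}}^0 B=B$, $\mathcal{L}_{\mathbf{f}}^k B=\langle \nabla\mathcal{L}_{\mathbf{f}}^{k-1}B,\mathbf{f}\rangle$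 for $k>0$. The completeness threshold $N_{B,\mathbf{f}}\in\mathbb{N}^+$ is the minimal index $i$ such that $\mathcal{L}_{\mathbf{f}}^{i+1}B$ lies in the ideal of $\mathbb{R}[\mathbf{x}]$ generated by $\mathcal{L}_{\mathbf{f}}^0B,\dots,\mathcal{L}_{\mathbf{f}}^iB$. A polynomial $B$ is an invariant barrier certificate iff (initial) $B(\mathbf{x})\le 0$ for all $\mathbf{x}\in\mathcal{X}_0$; (consecution) for all $\mathbf{x}\in\mathbb{R}^n$, $\bigwedge_{i=1}^{N_{B,\mathbf{f}}}\big((\bigwedge_{j=0}^{i-1}\mathcal{L}_{\mathbf{f}}^jB(\mathbf{x})=0)\implies\mathcal{L}_{\mathbf{f}}^iB(\mathbf{x})\le 0\big)$; (separation) $B(\mathbf{x})>0$ for all $\mathbf{x}\in\mathcal{X}_u$. *)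

theory Defs
  imports "HOL-Analysis.Analysis" "HOL-Library.Poly_Mapping"
begin

text \<open>
  The polynomial ring \<open>\<real>[x]\<close> in the variables \<open>x\<^sub>i\<close>, \<open>i :: 'n\<close>: monomials are exponent maps
  \<open>'n \<Rightarrow>\<^sub>0 nat\<close>, polynomials are finitely supported coefficient maps, and \<open>*\<close> is the
  convolution product of \<^theory>\<open>HOL-Library.Poly_Mapping\<close>.
\<close>

type_synonym 'n rpoly = "('n \<Rightarrow>\<^sub>0 nat) \<Rightarrow>\<^sub>0 real"

definition peval :: "'n::finite rpoly \<Rightarrow> real ^ 'n \<Rightarrow> real" where
  "peval p x =
     (\<Sum>m\<in>Poly_Mapping.keys p. Poly_Mapping.lookup p m * (\<Prod>i\<in>UNIV. (x $ i) ^ Poly_Mapping.lookup m i))"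

text \<open>
  Monomials not containing \<open>x\<^sub>i\<close>, for which the subtraction of exponents truncates, get coefficient \<open>0\<close>.
\<close>

definition pderiv_var :: "'n::finite \<Rightarrow> 'n rpoly \<Rightarrow> 'n rpoly" where
  "pderiv_var i p =
     (\<Sum>m\<in>Poly_Mapping.keys p.
        Poly_Mapping.single (m - Poly_Mapping.single i 1)
          (of_nat (Poly_Mapping.lookup m i) * Poly_Mapping.lookup p m))"

definition pgrad :: "'n::finite rpoly \<Rightarrow> 'n rpoly ^ 'n" where
  "pgrad p = (\<chi> i. pderiv_var i p)"

definition vfield :: "'n::finite rpoly ^ 'n \<Rightarrow> real ^ 'n \<Rightarrow> real ^ 'n" where
  "vfield f x = (\<chi> i. peval (f $ i) x)"

primrec lie :: "'n::finite rpoly ^ 'n \<Rightarrow> nat \<Rightarrow> 'n rpoly \<Rightarrow> 'n rpoly" where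
  "lie f 0 B = B"
| "lie f (Suc k) B = (\<Sum>i\<in>UNIV. pgrad (lie f k B) $ i * f $ i)"

text \<open>The ideal generated by a set is its span in the ring regarded as a module over itself.\<close>

definition ideal_gen :: "'a::comm_ring_1 set \<Rightarrow> 'a set" where
  "ideal_gen = module.span (*)"

text \<open>
  An index satisfying the condition below exists by Hilbert's basis theorem, so the
  \<open>LEAST\<close> is well defined.  The threshold is a positive number by convention, hence \<open>1 \<le> i\<close>.
\<close>

definition completeness_threshold :: "'n::finite rpoly \<Rightarrow> 'n rpoly ^ 'n \<Rightarrow> nat" where
  "completeness_threshold B f =
     (LEAST i. 1 \<le> i \<and> lie f (Suc i) B \<in> ideal_gen ((\<lambda>j. lie f j B) ` {0..i}))"

definition invariant_barrier_certificate ::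
  "'n::finite rpoly ^ 'n \<Rightarrow> (real ^ 'n) set \<Rightarrow> (real ^ 'n) set \<Rightarrow> 'n rpoly \<Rightarrow> bool" where
  "invariant_barrier_certificate f X0 Xu B \<longleftrightarrow>
     (\<forall>x\<in>X0. peval B x \<le> 0) \<and>
     (\<forall>x. \<forall>i\<in>{1..completeness_threshold B f}.
        (\<forall>j\<in>{0..i - 1}. peval (lie f j B) x = 0) \<longrightarrow> peval (lie f i B) x \<le> 0) \<and>
     (\<forall>x\<in>Xu. peval B x > 0)"

text \<open>
  Solutions on \<open>[0,T)\<close> with \<open>T \<in> \<real>\<^sup>+ \<union> {\<infinity>}\<close>; only the values of \<open>\<zeta>\<close> on \<open>[0,T)\<close> matter, and the
  derivative at \<open>0\<close> is one-sided.
\<close>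

definition solves_ivp ::
  "(real ^ 'n \<Rightarrow> real ^ 'n) \<Rightarrow> real ^ 'n::finite \<Rightarrow> ereal \<Rightarrow> (real \<Rightarrow> real ^ 'n) \<Rightarrow> bool" where
  "solves_ivp F x0 T \<zeta> \<longleftrightarrow>
     0 < T \<and> \<zeta> 0 = x0 \<and>
     (\<forall>t. 0 \<le> t \<and> ereal t < T \<longrightarrow>
        (\<zeta> has_vector_derivative F (\<zeta> t)) (at t within {s. 0 \<le> s \<and> ereal s < T}))"

definition maximal_solution ::
  "(real ^ 'n \<Rightarrow> real ^ 'n) \<Rightarrow> real ^ 'n::finite \<Rightarrow> ereal \<Rightarrow> (real \<Rightarrow> real ^ 'n) \<Rightarrow> bool" where
  "maximal_solution F x0 T \<zeta> \<longleftrightarrow>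
     solves_ivp F x0 T \<zeta> \<and> (\<forall>T' \<zeta>'. solves_ivp F x0 T' \<zeta>' \<longrightarrow> T' \<le> T)"

text \<open>
  For the locally Lipschitz fields considered here, \<open>T\<close> and the restriction of \<open>\<zeta>\<close> to \<open>[0,T)\<close>
  exist and are unique for each \<open>x0\<close>.
\<close>

definition inductive_invariant ::
  "(real ^ 'n \<Rightarrow> real ^ 'n) \<Rightarrow> (real ^ 'n::finite) set \<Rightarrow> bool" where
  "inductive_invariant F \<Psi> \<longleftrightarrow>
     (\<forall>x0\<in>\<Psi>. \<forall>T \<zeta>. maximal_solution F x0 T \<zeta> \<longrightarrow>
        (\<forall>t. 0 \<le> t \<and> ereal t < T \<longrightarrow> \<zeta> t \<in> \<Psi>))"

end

theory Submission
  imports Defs "HOL-Computational_Algebra.Primes"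
begin

text \<open>
  Along a solution, the functions \<open>g\<^sub>k = L\<^sub>f\<^sup>k B\<close> satisfy \<open>g\<^sub>k' = g\<^sub>k\<^sub>+\<^sub>1\<close>, so the first \<open>g\<^sub>k\<close> that is nonzero
  at a time \<open>s\<close> with \<open>g\<^sub>0 s = 0\<close> decides the sign of \<open>g\<^sub>0\<close> immediately after \<open>s\<close>.  This settles both
  implications except when \<open>g\<^sub>0, \<dots>, g\<^sub>N\<close> all vanish at \<open>s\<close> for the completeness threshold \<open>N\<close>.
  By Hilbert's basis theorem \<open>g\<^sub>N\<^sub>+\<^sub>1\<close> is a combination of \<open>g\<^sub>0, \<dots>, g\<^sub>N\<close> with continuous coefficients;
  then \<open>h = \<Sum>j\<le>N. g\<^sub>j\<^sup>2\<close> satisfies \<open>h' \<le> C h\<close>, and Gronwall's inequality gives \<open>g\<^sub>0 = 0\<close> from \<open>s\<close> on.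
  Necessity of the certificate needs a maximal solution through every point, obtained from
  the Picard--Lindeloef theorem by gluing.
\<close>

section \<open>Polynomials as functions\<close>

text \<open>Updating at a fresh key is adding a monomial, so \<open>update_induct\<close> becomes an
  induction suited to additive maps such as \<open>peval\<close> and
  \<open>pderiv_var\<close>.\<close>

lemma poly_mapping_monomial_induct [case_names zero add]:
  fixes p :: "'a \<Rightarrow>\<^sub>0 'b::comm_monoid_add"
  assumes "P 0" and "\<And>m c p. P p \<Longrightarrow> P (Poly_Mapping.single m c + p)"
  shows "P p"
proof (induction p rule: update_induct)
  case const
  then show ?case by (rule assms)
next
  case (update p a b)
  have "Poly_Mapping.update a b p = Poly_Mapping.single a b + p"
    using update.hyps
    by (intro poly_mapping_eqI) (auto simp: lookup_update lookup_add lookup_single when_def in_keys_iff)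
  with update show ?case using assms(2) by simp
qed

lemma peval_zero [simp]: "peval 0 x = 0"
  by (simp add: peval_def)

lemma peval_add: "peval (p + q) x = peval p x + peval q x"
  unfolding peval_def
  by (rule setsum_keys_plus_distrib) (auto simp: algebra_simps)

lemma peval_single:
  "peval (Poly_Mapping.single m c) x = c * (\<Prod>i\<in>UNIV. (x $ i) ^ Poly_Mapping.lookup m i)"
  by (simp add: peval_def)

lemma peval_mult: "peval (p * q) x = peval p x * peval q x"
proof (induction p rule: poly_mapping_monomial_induct)
  case (add m c p)
  have "peval (Poly_Mapping.single m c * q) x = peval (Poly_Mapping.single m c) x * peval q x"
  proof (induction q rule: poly_mapping_monomial_induct)
    case (add m' c' q)
    then show ?case
      by (simp add: distrib_left peval_add mult_single peval_single lookup_add power_add prod.distrib)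
  qed simp
  with add show ?case by (simp add: distrib_right peval_add)
qed simp

lemma peval_sum: "peval (\<Sum>a\<in>A. g a) x = (\<Sum>a\<in>A. peval (g a) x)"
  by (induction A rule: infinite_finite_induct) (auto simp: peval_add)

lemma pderiv_var_zero [simp]: "pderiv_var i 0 = 0"
  by (simp add: pderiv_var_def)

lemma pderiv_var_add: "pderiv_var i (p + q) = pderiv_var i p + pderiv_var i q"
  unfolding pderiv_var_def
  by (rule setsum_keys_plus_distrib) (auto simp: algebra_simps single_add)

lemma pderiv_var_single:
  "pderiv_var i (Poly_Mapping.single m c) =
   Poly_Mapping.single (m - Poly_Mapping.single i 1) (of_nat (Poly_Mapping.lookup m i) * c)"
  by (simp add: pderiv_var_def)

lemma has_derivative_peval:
  "(peval p has_derivative (\<lambda>h. \<Sum>i\<in>UNIV. peval (pderiv_var i p) x * h $ i)) (at x)"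
proof (induction p rule: poly_mapping_monomial_induct)
  case zero
  then show ?case by (simp add: peval_def[abs_def])
next
  case (add m c p)
  have "((\<lambda>x. c * (\<Prod>i\<in>UNIV. (x $ i) ^ Poly_Mapping.lookup m i)) has_derivative
      (\<lambda>h. c * (\<Sum>i\<in>UNIV. (of_nat (Poly_Mapping.lookup m i) * h $ i * (x $ i) ^ (Poly_Mapping.lookup m i - 1)) *
           (\<Prod>j\<in>UNIV - {i}. (x $ j) ^ Poly_Mapping.lookup m j)))) (at x)"
    by (auto intro!: derivative_eq_intros bounded_linear_imp_has_derivative)
  moreover have "peval (pderiv_var i (Poly_Mapping.single m c)) x =
      c * of_nat (Poly_Mapping.lookup m i) * (x $ i) ^ (Poly_Mapping.lookup m i - 1) *
           (\<Prod>j\<in>UNIV - {i}. (x $ j) ^ Poly_Mapping.lookup m j)" for i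
  proof -
    \<comment> \<open>Lowering the exponent of variable \<open>i\<close> leaves the factors of the
      other variables unchanged.\<close>
    have "(\<Prod>j\<in>UNIV - {i}. (x $ j) ^ (Poly_Mapping.lookup m j - (if i = j then 1 else 0))) =
        (\<Prod>j\<in>UNIV - {i}. (x $ j) ^ Poly_Mapping.lookup m j)"
      by (rule prod.cong) auto
    then show ?thesis
      by (simp add: pderiv_var_single peval_single prod.remove[of UNIV i] lookup_minus lookup_single when_def)
  qed
  ultimately have "(peval (Poly_Mapping.single m c) has_derivative
      (\<lambda>h. \<Sum>i\<in>UNIV. peval (pderiv_var i (Poly_Mapping.single m c)) x * h $ i)) (at x)"
    by (simp add: peval_single[abs_def] sum_distrib_left mult_ac)
  from has_derivative_add[OF this add] show ?case
    by (simp add: peval_add[abs_def] pderiv_var_add sum.distrib distrib_right)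
qed

lemma continuous_on_peval: "continuous_on S (peval p)"
  by (intro continuous_at_imp_continuous_on ballI) (rule has_derivative_continuous[OF has_derivative_peval])

section \<open>The ascending chain condition for polynomial ideals\<close>

text \<open>By cancellation, \<open>a + m' = a + m\<close> only for \<open>m' = m\<close>, so a
  single term contributes. This gives the leading coefficient after multiplication by a
  monomial.\<close>

lemma lookup_single_mult_add:
  fixes q :: "('a::cancel_comm_monoid_add) \<Rightarrow>\<^sub>0 'b::semiring_0"
  shows "Poly_Mapping.lookup (Poly_Mapping.single a c * q) (a + m) = c * Poly_Mapping.lookup q m"
proof (induction q rule: poly_mapping_monomial_induct)
  case (add m' c' q)
  then show ?case
    by (simp add: distrib_left lookup_add mult_single lookup_single when_def)
qed simp

section \<open>Dickson's lemma\<close>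

text \<open>Some subsequence is monotone. If it is decreasing, it is constant from the index where
  it attains its minimum, and that tail is increasing as well.\<close>

lemma nat_seq_incseq_subseq:
  fixes s :: "nat \<Rightarrow> nat"
  shows "\<exists>r. strict_mono r \<and> incseq (\<lambda>n. s (r n))"
proof -
  obtain r where r: "strict_mono r" "monoseq (\<lambda>n. s (r n))" using seq_monosub by blast
  show ?thesis
  proof (cases "incseq (\<lambda>n. s (r n))")
    case False
    then have dec: "decseq (\<lambda>n. s (r n))" using r(2) by (simp add: monoseq_iff)
    obtain N where N: "\<And>n. s (r N) \<le> s (r n)"
      using ex_has_least_nat[of "\<lambda>_. True" undefined "\<lambda>n. s (r n)"] by blast
    have "s (r (N + n)) = s (r N)" for n
      using N dec by (simp add: antisym decseq_def)
    moreover have "strict_mono (\<lambda>n. r (N + n))"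
      using r(1) by (simp add: strict_mono_def)
    ultimately show ?thesis by (intro exI[of _ "\<lambda>n. r (N + n)"]) (simp add: incseq_def)
  qed (use r in blast)
qed

text \<open>Coordinates are treated one at a time: thinning out a subsequence preserves the
  monotonicity already achieved.\<close>

lemma dickson_subseq:
  fixes s :: "nat \<Rightarrow> 'a \<Rightarrow> nat"
  assumes "finite V"
  shows "\<exists>r. strict_mono r \<and> (\<forall>v\<in>V. incseq (\<lambda>n. s (r n) v))"
  using assms
proof (induction V)
  case empty
  then show ?case using strict_mono_id by auto
next
  case (insert v V)
  then obtain r where r: "strict_mono r" "\<forall>v\<in>V. incseq (\<lambda>n. s (r n) v)" by blast
  obtain r' where r': "strict_mono r'" "incseq (\<lambda>n. s (r (r' n)) v)"
    using nat_seq_incseq_subseq[of "\<lambda>n. s (r n) v"] by blast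
  show ?case
    using r r' strict_mono_less_eq[OF r'(1)] by (intro exI[of _ "\<lambda>n. r (r' n)"])
      (auto simp: strict_mono_def incseq_def)
qed

lemma dickson:
  fixes s :: "nat \<Rightarrow> 'a::finite \<Rightarrow>\<^sub>0 nat"
  shows "\<exists>i j a. i < j \<and> s j = a + s i"
proof -
  obtain r where r: "strict_mono r" "\<forall>v\<in>UNIV. incseq (\<lambda>n. Poly_Mapping.lookup (s (r n)) v)"
    using dickson_subseq[of UNIV "\<lambda>n. Poly_Mapping.lookup (s n)"] by auto
  \<comment> \<open>Every exponent of \<open>s (r 0)\<close> is at most that of
    \<open>s (r 1)\<close>, so the truncated subtraction is exact and yields the quotient
    monomial.\<close>
  have "s (r 1) = (s (r 1) - s (r 0)) + s (r 0)"
    using r(2) by (intro poly_mapping_eqI) (simp add: lookup_add lookup_minus incseq_def)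
  moreover have "r 0 < r 1" using r(1) by (simp add: strict_mono_def)
  ultimately show ?thesis by blast
qed

text \<open>
  Encoding exponent vectors as natural numbers by prime factorisation turns the order of the natural
  numbers into a monomial order.
\<close>

lemma ex_monomial_order:
  "\<exists>\<phi> :: ('n::finite \<Rightarrow>\<^sub>0 nat) \<Rightarrow> nat. inj \<phi> \<and> (\<forall>a b. \<phi> (a + b) = \<phi> a * \<phi> b)"
proof -
  obtain e :: "'n \<Rightarrow> nat" where e: "inj e" "\<And>i. prime (e i)"
  proof -
    obtain P where P: "P \<subseteq> {p::nat. prime p}" "finite P" "card P = CARD('n)"
      using infinite_arbitrarily_large[OF primes_infinite] by blast
    then obtain e where "bij_betw e (UNIV::'n set) P"
      using finite_same_card_bij[of "UNIV :: 'n set" P] by auto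
    then show ?thesis using that[of e] P(1) by (auto simp: bij_betw_def)
  qed
  define \<phi> where "\<phi> m = (\<Prod>i\<in>UNIV. e i ^ Poly_Mapping.lookup m i)" for m :: "'n \<Rightarrow>\<^sub>0 nat"
  have "multiplicity (e i) (\<phi> m) = Poly_Mapping.lookup m i" for m i
  proof -
    have "\<phi> m = (\<Prod>p\<in>range e. p ^ Poly_Mapping.lookup m (inv e p))"
      using e(1) by (simp add: \<phi>_def prod.reindex)
    then show ?thesis
      using e multiplicity_prod_prime_powers[of "range e" "e i" "\<lambda>p. Poly_Mapping.lookup m (inv e p)"]
      by auto
  qed
  then have "inj \<phi>" by (metis injI poly_mapping_eqI)
  moreover have "\<phi> (a + b) = \<phi> a * \<phi> b" for a b
    by (simp add: \<phi>_def lookup_add power_add prod.distrib)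
  ultimately show ?thesis by blast
qed

section \<open>Ideals and the chain condition\<close>

lemma module_times: "module ((*) :: 'a::comm_ring_1 \<Rightarrow> 'a \<Rightarrow> 'a)"
  by unfold_locales (auto simp: algebra_simps)

lemmas ideal_gen_base = module.span_base[OF module_times, folded ideal_gen_def]
lemmas ideal_gen_add = module.span_add[OF module_times, folded ideal_gen_def]
lemmas ideal_gen_diff = module.span_diff[OF module_times, folded ideal_gen_def]
lemmas ideal_gen_mult = module.span_scale[OF module_times, folded ideal_gen_def]
lemmas ideal_gen_zero = module.span_zero[OF module_times, folded ideal_gen_def]
lemmas ideal_gen_mono = module.span_mono[OF module_times, folded ideal_gen_def]
lemmas ideal_gen_induct = module.span_induct_alt[OF module_times, folded ideal_gen_def]

text \<open>
  The element chosen from each coset \<open>p i + \<langle>p 0, \<dots>, p (i - 1)\<rangle>\<close> has the least possible leading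
  monomial, so the divisibility provided by Dickson's lemma contradicts minimality.
\<close>

theorem ex_mem_ideal_gen_predecessors:
  fixes p :: "nat \<Rightarrow> 'n::finite rpoly"
  shows "\<exists>i\<ge>n0. p i \<in> ideal_gen (p ` {..<i})"
proof (rule ccontr)
  assume "\<not> ?thesis"
  then have bad: "p i \<notin> ideal_gen (p ` {..<i})" if "i \<ge> n0" for i using that by blast
  obtain \<phi> :: "('n \<Rightarrow>\<^sub>0 nat) \<Rightarrow> nat"
    where \<phi>: "inj \<phi>" "\<And>a b. \<phi> (a + b) = \<phi> a * \<phi> b"
    using ex_monomial_order by blast
  define d where "d q = Max (\<phi> ` Poly_Mapping.keys q)" for q :: "'n rpoly"
  define C where "C i = {q. q - p i \<in> ideal_gen (p ` {..<i})}" for i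
  \<comment> \<open>If 0 were in the coset, \<open>p i\<close> would lie in the ideal of its
    predecessors. Hence \<open>d\<close> is never evaluated at 0, where \<open>Max {}\<close> is
    unspecified, for indices from \<open>n0\<close> on.\<close>
  have nz: "q \<noteq> 0" if "q \<in> C i" "i \<ge> n0" for q i
    using ideal_gen_mult[of "0 - p i" "p ` {..<i}" "-1"] that bad by (auto simp: C_def)
  have "\<exists>q. q \<in> C i \<and> (\<forall>q'\<in>C i. d q \<le> d q')" for i
  proof -
    have "p i \<in> C i" by (simp add: C_def ideal_gen_zero)
    then show ?thesis using ex_has_least_nat[of "\<lambda>q. q \<in> C i" "p i" d] by blast
  qed
  then obtain q where q: "\<And>i. q i \<in> C i" and q_min: "\<And>i q'. q' \<in> C i \<Longrightarrow> d (q i) \<le> d q'"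
    by metis
  have "\<exists>m. m \<in> Poly_Mapping.keys (q i) \<and> \<phi> m = d (q i)" if "i \<ge> n0" for i
  proof -
    have "d (q i) \<in> \<phi> ` Poly_Mapping.keys (q i)"
      unfolding d_def using nz[OF q that] by (intro Max_in) auto
    then show ?thesis by auto
  qed
  then obtain l where l: "\<And>i. i \<ge> n0 \<Longrightarrow> l i \<in> Poly_Mapping.keys (q i)"
    and l_max: "\<And>i. i \<ge> n0 \<Longrightarrow> \<phi> (l i) = d (q i)" by metis
  obtain i' j' a where ij': "i' < j'" "l (n0 + j') = a + l (n0 + i')"
    using dickson[of "\<lambda>i. l (n0 + i)"] by blast
  define i j where "i = n0 + i'" and "j = n0 + j'"
  have ij: "i < j" "i \<ge> n0" "j \<ge> n0" "l j = a + l i" using ij' by (auto simp: i_def j_def)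
  \<comment> \<open>This coefficient makes the leading terms of \<open>q j\<close> and
    \<open>single a c * q i\<close> cancel. The second product lies in the ideal, so
    \<open>q'\<close> remains in the coset of \<open>p j\<close>.\<close>
  define c where "c = Poly_Mapping.lookup (q j) (l j) / Poly_Mapping.lookup (q i) (l i)"
  define q' where "q' = q j - Poly_Mapping.single a c * q i"
  have "q i \<in> ideal_gen (p ` {..<j})"
  proof -
    have "p ` {..<i} \<subseteq> p ` {..<j}" using ij(1) by auto
    then have "q i - p i \<in> ideal_gen (p ` {..<j})"
      using q[of i] ideal_gen_mono unfolding C_def by blast
    moreover have "p i \<in> ideal_gen (p ` {..<j})" using ij(1) by (intro ideal_gen_base) auto
    ultimately show ?thesis using ideal_gen_add by fastforce
  qed
  then have "(q j - p j) - Poly_Mapping.single a c * q i \<in> ideal_gen (p ` {..<j})"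
    using q[of j] ideal_gen_diff ideal_gen_mult unfolding C_def by blast
  then have q'C: "q' \<in> C j" by (simp add: C_def q'_def algebra_simps)
  have "\<phi> m < d (q j)" if m: "m \<in> Poly_Mapping.keys q'" for m
  proof -
    have le: "\<phi> m' \<le> d (q k)" if "m' \<in> Poly_Mapping.keys (q k)" for m' k
      unfolding d_def using that by (intro Max_ge) auto
    have "\<phi> m \<le> d (q j)"
    proof (cases "m \<in> Poly_Mapping.keys (q j)")
      case False
      then have "m \<in> Poly_Mapping.keys (Poly_Mapping.single a c * q i)"
        using m by (auto simp: q'_def in_keys_iff lookup_minus)
      then obtain m' where m': "m = a + m'" "m' \<in> Poly_Mapping.keys (q i)"
        using keys_mult[of "Poly_Mapping.single a c" "q i"] by (auto split: if_splits)
      \<comment> \<open>Multiplicativity of \<open>\<phi>\<close> makes the order compatible with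
        products, so no monomial of the shifted \<open>q i\<close> exceeds its shifted leading
        monomial \<open>a + l i = l j\<close>.\<close>
      have "\<phi> m \<le> \<phi> a * d (q i)" using le[OF m'(2)] by (simp add: m'(1) \<phi>(2))
      also have "\<dots> = d (q j)" using l_max[of i] l_max[of j] ij by (metis \<phi>(2))
      finally show ?thesis .
    qed (rule le)
    moreover have "Poly_Mapping.lookup q' (l j) = 0"
      using l[of i] ij by (simp add: q'_def lookup_minus lookup_single_mult_add c_def in_keys_iff)
    then have "m \<noteq> l j" using m by (auto simp: in_keys_iff)
    then have "\<phi> m \<noteq> d (q j)" using \<phi>(1) l_max[OF ij(3)] by (metis injD)
    ultimately show ?thesis by simp
  qed
  moreover have "Poly_Mapping.keys q' \<noteq> {}" using nz[OF q'C ij(3)] by simp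
  ultimately have "d q' < d (q j)" unfolding d_def[of q'] by (subst Max_less_iff) auto
  then show False using q_min[OF q'C] by simp
qed

text \<open>The chain condition supplies an admissible index, so the \<open>LEAST\<close> satisfies
  its defining condition.\<close>

lemma lie_completeness_threshold:
  "lie f (Suc (completeness_threshold B f)) B
     \<in> ideal_gen ((\<lambda>j. lie f j B) ` {0..completeness_threshold B f})"
proof -
  \<comment> \<open>The candidate threshold is \<open>i - 1\<close>; starting at 2 keeps it
    positive.\<close>
  obtain i where i: "i \<ge> 2" "lie f i B \<in> ideal_gen ((\<lambda>j. lie f j B) ` {..<i})"
    using ex_mem_ideal_gen_predecessors[of 2 "\<lambda>j. lie f j B"] by blast
  moreover have "{..<i} = {0..i - 1}" using i(1) by auto
  ultimately have "1 \<le> i - 1 \<and> lie f (Suc (i - 1)) B \<in> ideal_gen ((\<lambda>j. lie f j B) ` {0..i - 1})"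
    by (simp del: lie.simps)
  from LeastI[of "\<lambda>i. 1 \<le> i \<and> lie f (Suc i) B \<in> ideal_gen ((\<lambda>j. lie f j B) ` {0..i})", OF this]
  show ?thesis
    unfolding completeness_threshold_def by blast
qed

section \<open>Ordinary differential equations\<close>

text \<open>With the integrating factor \<open>exp (- C * t)\<close>, the product has nonpositive
  derivative and thus cannot rise above its initial value.\<close>

lemma gronwall_nonpos:
  fixes h h' :: "real \<Rightarrow> real"
  assumes "a \<le> b"
    and der: "\<And>t. a \<le> t \<Longrightarrow> t \<le> b \<Longrightarrow> (h has_real_derivative h' t) (at t within {a..b})"
    and le: "\<And>t. a \<le> t \<Longrightarrow> t \<le> b \<Longrightarrow> h' t \<le> C * h t"
    and "h a \<le> 0"
  shows "h b \<le> 0"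
proof -
  let ?k = "\<lambda>t. exp (- C * t) * h t"
  have der_k: "(?k has_real_derivative exp (- C * t) * (h' t - C * h t)) (at t within {a..b})"
    if "a \<le> t" "t \<le> b" for t
    by (rule derivative_eq_intros der[OF that] refl)+ (simp add: algebra_simps)
  have "?k b \<le> ?k a"
  proof (rule DERIV_nonpos_imp_decreasing_open[OF \<open>a \<le> b\<close>])
    fix t assume t: "a < t" "t < b"
    have "exp (- C * t) * (h' t - C * h t) \<le> 0"
      using le[of t] t by (intro mult_nonneg_nonpos) auto
    then show "\<exists>y. (?k has_real_derivative y) (at t) \<and> y \<le> 0"
      using der_k[of t] t by (auto simp: at_within_Icc_at)
  next
    show "continuous_on {a..b} ?k"
      using der_k by (intro DERIV_continuous_on) auto
  qed
  also have "\<dots> \<le> 0" using \<open>h a \<le> 0\<close> by (simp add: mult_nonneg_nonpos)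
  finally show ?thesis by (simp add: mult_le_0_iff)
qed

text \<open>By induction on \<open>k\<close>, the shifted family makes \<open>g 1\<close> positive
  to the right of \<open>s\<close>, so \<open>g 0\<close> increases strictly from 0. The base case
  is continuity.\<close>

lemma pos_right_of_first_nonzero_derivative:
  fixes g :: "nat \<Rightarrow> real \<Rightarrow> real"
  assumes "s < e"
    and "\<And>j t. s \<le> t \<Longrightarrow> t \<le> e \<Longrightarrow> (g j has_real_derivative g (Suc j) t) (at t within {s..e})"
    and "\<And>j. j < k \<Longrightarrow> g j s = 0" and "g k s > 0"
  shows "\<exists>d>s. d \<le> e \<and> (\<forall>t. s < t \<and> t \<le> d \<longrightarrow> g 0 t > 0)"
  using assms(2-)
proof (induction k arbitrary: g)
  case 0
  have "(g 0 \<longlongrightarrow> g 0 s) (at s within {s..e})"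
    using DERIV_continuous[OF "0.prems"(1)[of s 0]] \<open>s < e\<close> by (simp add: continuous_within)
  from order_tendstoD(1)[OF this \<open>0 < g 0 s\<close>]
  obtain r where r: "r > 0" "\<And>t. t \<in> {s..e} \<Longrightarrow> t \<noteq> s \<Longrightarrow> dist t s < r \<Longrightarrow> g 0 t > 0"
    unfolding eventually_at by blast
  show ?case
    using r \<open>s < e\<close> by (intro exI[of _ "min e (s + r / 2)"]) (auto simp: dist_real_def)
next
  case (Suc k)
  have "\<exists>d>s. d \<le> e \<and> (\<forall>t. s < t \<and> t \<le> d \<longrightarrow> g (Suc 0) t > 0)"
    using Suc.prems by (intro Suc.IH[of "\<lambda>j. g (Suc j)"]) auto
  then obtain d where d: "d > s" "d \<le> e" "\<And>t. s < t \<Longrightarrow> t \<le> d \<Longrightarrow> g (Suc 0) t > 0" by blast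
  have "g 0 s < g 0 t" if t: "s < t" "t \<le> d" for t
  proof (rule DERIV_pos_imp_increasing_open[OF t(1)])
    fix x assume "s < x" "x < t"
    then show "\<exists>y. (g 0 has_real_derivative y) (at x) \<and> 0 < y"
      using Suc.prems(1)[of x 0] d t by (auto simp: at_within_Icc_at)
  next
    have "continuous_on {s..e} (g 0)"
      using Suc.prems(1) by (intro DERIV_continuous_on) auto
    then show "continuous_on {s..t} (g 0)"
      by (rule continuous_on_subset) (use d t in auto)
  qed
  then show ?case using d Suc.prems(2)[of 0] by auto
qed

section \<open>Lipschitz bounds on balls\<close>

text \<open>The partial derivatives are bounded on the compact ball, and the ball is convex, so the
  mean value inequality applies.\<close>

lemma peval_lipschitz_on_cball: "\<exists>L. L-lipschitz_on (cball a R) (peval p)"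
proof -
  let ?D = "\<lambda>x. \<Sum>i\<in>UNIV. \<bar>peval (pderiv_var i p) x\<bar>"
  have "compact (?D ` cball a R)"
    by (intro compact_continuous_image continuous_intros continuous_on_peval compact_cball)
  then obtain M where M: "\<And>x. x \<in> cball a R \<Longrightarrow> ?D x \<le> M"
    using compact_imp_bounded[THEN bounded_imp_bdd_above] by (fastforce simp: bdd_above_def)
  \<comment> \<open>For negative \<open>R\<close> the ball is empty and \<open>M\<close> may be
    negative; the maximum keeps the constant admissible.\<close>
  have "(max M 0)-lipschitz_on (cball a R) (peval p)"
  proof (rule lipschitz_onI)
    fix x y assume xy: "x \<in> cball a R" "y \<in> cball a R"
    have "norm (peval p x - peval p y) \<le> max M 0 * norm (x - y)"
    proof (rule differentiable_bound[OF convex_cball _ _ xy])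
      fix z assume z: "z \<in> cball a R"
      show "(peval p has_derivative (\<lambda>h. \<Sum>i\<in>UNIV. peval (pderiv_var i p) z * h $ i)) (at z within cball a R)"
        by (rule has_derivative_at_withinI[OF has_derivative_peval])
      show "onorm (\<lambda>h. \<Sum>i\<in>UNIV. peval (pderiv_var i p) z * h $ i) \<le> max M 0"
      proof (rule onorm_le)
        fix h :: "real ^ 'a"
        have "norm (\<Sum>i\<in>UNIV. peval (pderiv_var i p) z * h $ i) \<le> ?D z * norm h"
          unfolding sum_distrib_right
          by (rule sum_norm_le) (simp add: abs_mult component_le_norm_cart mult_left_mono)
        also have "\<dots> \<le> max M 0 * norm h" using M[OF z] by (intro mult_right_mono) auto
        finally show "norm (\<Sum>i\<in>UNIV. peval (pderiv_var i p) z * h $ i) \<le> max M 0 * norm h" .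
      qed
    qed
    then show "dist (peval p x) (peval p y) \<le> max M 0 * dist x y" by (simp add: dist_norm)
  qed simp
  then show ?thesis ..
qed

lemma vfield_lipschitz_on_cball: "\<exists>L. L-lipschitz_on (cball a R) (vfield f)"
proof -
  have "\<forall>i. \<exists>L. L-lipschitz_on (cball a R) (peval (f $ i))"
    by (intro allI peval_lipschitz_on_cball)
  then obtain L where L: "\<And>i. (L i)-lipschitz_on (cball a R) (peval (f $ i))"
    unfolding choice_iff by blast
  have "(\<Sum>i\<in>UNIV. L i)-lipschitz_on (cball a R) (vfield f)"
  proof (rule lipschitz_onI)
    fix x y assume xy: "x \<in> cball a R" "y \<in> cball a R"
    have "norm (vfield f x - vfield f y) \<le> (\<Sum>i\<in>UNIV. \<bar>(vfield f x - vfield f y) $ i\<bar>)"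
      by (rule norm_le_l1_cart)
    also have "\<dots> \<le> (\<Sum>i\<in>UNIV. L i * dist x y)"
      using lipschitz_onD[OF L xy] by (intro sum_mono) (simp add: vfield_def dist_real_def)
    finally show "dist (vfield f x) (vfield f y) \<le> (\<Sum>i\<in>UNIV. L i) * dist x y"
      by (simp add: dist_norm sum_distrib_right)
  qed (intro sum_nonneg lipschitz_on_nonneg[OF L])
  then show ?thesis ..
qed

section \<open>Uniqueness, local existence and maximal solutions\<close>

text \<open>Both curves stay in one ball, on which \<open>F\<close> is \<open>L\<close>-Lipschitz.
  Their squared distance \<open>h\<close> satisfies \<open>h' \<le> 2 * L * h\<close> and starts at
  0, so Gronwall applies.\<close>

lemma ode_solution_unique:
  fixes u v :: "real \<Rightarrow> 'a::euclidean_space"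
  assumes lips: "\<And>R. \<exists>L. L-lipschitz_on (cball 0 R) F"
    and "0 \<le> b" and "u 0 = v 0"
    and u: "\<And>t. 0 \<le> t \<Longrightarrow> t \<le> b \<Longrightarrow> (u has_vector_derivative F (u t)) (at t within {0..b})"
    and v: "\<And>t. 0 \<le> t \<Longrightarrow> t \<le> b \<Longrightarrow> (v has_vector_derivative F (v t)) (at t within {0..b})"
  shows "u b = v b"
proof -
  have "continuous_on {0..b} u" "continuous_on {0..b} v"
    using u v by (auto intro!: continuous_on_vector_derivative)
  then have "bounded (u ` {0..b} \<union> v ` {0..b})"
    by (auto intro!: compact_imp_bounded compact_continuous_image)
  then obtain R where R: "\<And>t. t \<in> {0..b} \<Longrightarrow> u t \<in> cball 0 R \<and> v t \<in> cball 0 R"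
    unfolding bounded_iff by fastforce
  obtain L where L: "L-lipschitz_on (cball 0 R) F" using lips by blast
  have "(u b - v b) \<bullet> (u b - v b) \<le> 0"
  proof (rule gronwall_nonpos[where a = 0 and C = "2 * L"
        and h = "\<lambda>t. (u t - v t) \<bullet> (u t - v t)" and h' = "\<lambda>t. 2 * ((u t - v t) \<bullet> (F (u t) - F (v t)))"])
    fix t assume t: "0 \<le> t" "t \<le> b"
    have "((\<lambda>t. (u t - v t) \<bullet> (u t - v t)) has_derivative
        (\<lambda>h. (u t - v t) \<bullet> (h *\<^sub>R (F (u t) - F (v t))) + (h *\<^sub>R (F (u t) - F (v t))) \<bullet> (u t - v t)))
        (at t within {0..b})"
      using has_vector_derivative_diff[OF u[OF t] v[OF t]]
      unfolding has_vector_derivative_def by (intro has_derivative_inner)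
    then show "((\<lambda>t. (u t - v t) \<bullet> (u t - v t)) has_real_derivative
        2 * ((u t - v t) \<bullet> (F (u t) - F (v t)))) (at t within {0..b})"
      unfolding has_field_derivative_def
      by (rule has_derivative_eq_rhs) (auto simp: inner_commute algebra_simps)
    have "(u t - v t) \<bullet> (F (u t) - F (v t)) \<le> norm (u t - v t) * norm (F (u t) - F (v t))"
      by (rule norm_cauchy_schwarz)
    also have "\<dots> \<le> norm (u t - v t) * (L * norm (u t - v t))"
      using lipschitz_onD[OF L, of "u t" "v t"] R[of t] t by (intro mult_left_mono) (auto simp: dist_norm)
    also have "\<dots> = L * ((u t - v t) \<bullet> (u t - v t))" by (simp add: dot_square_norm power2_eq_square)
    finally show "2 * ((u t - v t) \<bullet> (F (u t) - F (v t))) \<le> 2 * L * ((u t - v t) \<bullet> (u t - v t))"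
      by simp
  qed (use assms in auto)
  then show ?thesis by (metis inner_ge_zero antisym inner_eq_zero_iff right_minus_eq)
qed

text \<open>The Picard integral operator is a contraction of the complete space of bounded
  continuous functions for short times; its fixed point is the solution.\<close>

lemma picard_lindelof_global:
  fixes G :: "'a::euclidean_space \<Rightarrow> 'a"
  assumes L: "L-lipschitz_on UNIV G"
  shows "\<exists>\<delta>>0. \<exists>u. u 0 = x0 \<and>
    (\<forall>t\<in>{0..\<delta>}. (u has_vector_derivative G (u t)) (at t within {0..\<delta>}))"
proof -
  \<comment> \<open>The contraction factor \<open>L * \<delta>\<close> is below 1/2; adding 1 covers
    \<open>L = 0\<close>.\<close>
  define \<delta> where "\<delta> = 1 / (2 * (L + 1))"
  have "L \<ge> 0" using L by (rule lipschitz_on_nonneg)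
  then have \<delta>: "\<delta> > 0" "L * \<delta> < 1" by (auto simp: \<delta>_def field_simps)
  \<comment> \<open>Clamping time to \<open>[0, \<delta>]\<close> makes every iterate a bounded
    continuous function on all of the reals, so Banach's theorem can be used on the whole type
    \<open>bcontfun\<close>.\<close>
  define cl where "cl t = min \<delta> (max 0 t)" for t :: real
  have cl: "0 \<le> cl t" "cl t \<le> \<delta>" for t using \<delta> by (auto simp: cl_def)
  have cont_G: "continuous_on S (\<lambda>s. G (apply_bcontfun u s))" for S and u :: "real \<Rightarrow>\<^sub>C 'a"
    using lipschitz_on_continuous_on[OF L]
    by (rule continuous_on_compose2[where g = G]) auto
  define P where "P u t = x0 + integral {0..cl t} (\<lambda>s. G (apply_bcontfun u s))" for u t
  have P: "P u \<in> bcontfun" for u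
  proof -
    let ?I = "\<lambda>t. x0 + integral {0..t} (\<lambda>s. G (apply_bcontfun u s))"
    have I: "continuous_on {0..\<delta>} ?I"
      by (intro continuous_intros indefinite_integral_continuous_1 integrable_continuous_interval cont_G)
    have "continuous_on UNIV (\<lambda>t. ?I (cl t))"
      by (rule continuous_on_compose2[OF I]) (use cl in \<open>auto simp: cl_def intro!: continuous_on_min continuous_on_max continuous_on_const continuous_on_id\<close>)
    moreover have "bounded (range (\<lambda>t. ?I (cl t)))"
      using compact_imp_bounded[OF compact_continuous_image[OF I compact_Icc]]
      by (rule bounded_subset) (auto simp: cl)
    ultimately show ?thesis by (simp add: bcontfun_def P_def[abs_def])
  qed
  have "\<exists>!u. Bcontfun (P u) = u"
  proof (rule banach_fix_type[OF _ \<delta>(2)])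
    show "0 \<le> L * \<delta>" using \<delta> \<open>L \<ge> 0\<close> by simp
    show "\<forall>u v. dist (Bcontfun (P u)) (Bcontfun (P v)) \<le> L * \<delta> * dist u v"
    proof (intro allI dist_bound)
      fix u v :: "real \<Rightarrow>\<^sub>C 'a" and t
      have "dist (P u t) (P v t) =
          norm (integral {0..cl t} (\<lambda>s. G (apply_bcontfun u s) - G (apply_bcontfun v s)))"
        by (simp add: P_def dist_norm integral_diff integrable_continuous_interval cont_G)
      also have "\<dots> \<le> (L * dist u v) * (cl t - 0)"
      proof (rule integral_bound)
        fix s
        have "norm (G (apply_bcontfun u s) - G (apply_bcontfun v s)) \<le>
            L * dist (apply_bcontfun u s) (apply_bcontfun v s)"
          using lipschitz_onD[OF L] by (simp add: dist_norm)
        also have "\<dots> \<le> L * dist u v" using \<open>L \<ge> 0\<close> by (intro mult_left_mono dist_bounded)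
        finally show "norm (G (apply_bcontfun u s) - G (apply_bcontfun v s)) \<le> L * dist u v" .
      qed (use cl in \<open>auto intro!: continuous_intros cont_G\<close>)
      also have "\<dots> \<le> (L * dist u v) * \<delta>" using cl[of t] \<open>L \<ge> 0\<close> by (intro mult_left_mono) auto
      finally show "dist (apply_bcontfun (Bcontfun (P u)) t) (apply_bcontfun (Bcontfun (P v)) t)
          \<le> L * \<delta> * dist u v"
        by (simp add: Bcontfun_inverse[OF P] mult_ac)
    qed
  qed
  then obtain u where "Bcontfun (P u) = u" by blast
  then have u: "apply_bcontfun u t = P u t" for t by (metis Bcontfun_inverse[OF P])
  have u_int: "apply_bcontfun u t = x0 + integral {0..t} (\<lambda>s. G (apply_bcontfun u s))"
    if "t \<in> {0..\<delta>}" for t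
    using that by (subst u) (simp add: P_def cl_def)
  have "(apply_bcontfun u has_vector_derivative G (apply_bcontfun u t)) (at t within {0..\<delta>})"
    if t: "t \<in> {0..\<delta>}" for t
  proof (rule has_vector_derivative_transform[OF t])
    show "((\<lambda>t. x0 + integral {0..t} (\<lambda>s. G (apply_bcontfun u s))) has_vector_derivative
        G (apply_bcontfun u t)) (at t within {0..\<delta>})"
      using has_vector_derivative_add[OF has_vector_derivative_const
          integral_has_vector_derivative[OF cont_G t]] by simp
  qed (simp add: u_int)
  moreover have "apply_bcontfun u 0 = x0" using u_int[of 0] \<delta> by simp
  ultimately show ?thesis using \<delta>(1) by blast
qed

lemma ereal_interval_eq_atLeastLessThan: "{s. 0 \<le> s \<and> ereal s < ereal d} = {0..<d}"
  by auto

text \<open>Composing with the projection onto a ball around \<open>x0\<close> makes the field globally Lipschitz.\<close>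

lemma ex_solves_ivp:
  fixes F :: "real ^ 'n::finite \<Rightarrow> real ^ 'n"
  assumes "L-lipschitz_on (cball x0 1) F"
  shows "\<exists>T u. solves_ivp F x0 T u"
proof -
  let ?pr = "closest_point (cball x0 1)"
  have pr: "?pr x \<in> cball x0 1" for x by (rule closest_point_in_set) auto
  have "L-lipschitz_on UNIV (\<lambda>x. F (?pr x))"
  proof (rule lipschitz_onI)
    fix x y
    have "dist (F (?pr x)) (F (?pr y)) \<le> L * dist (?pr x) (?pr y)"
      by (rule lipschitz_onD[OF assms pr pr])
    also have "\<dots> \<le> L * dist x y"
      by (intro mult_left_mono closest_point_lipschitz lipschitz_on_nonneg[OF assms]) auto
    finally show "dist (F (?pr x)) (F (?pr y)) \<le> L * dist x y" .
  qed (rule lipschitz_on_nonneg[OF assms])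
  from picard_lindelof_global[OF this, of x0]
  obtain \<delta> u where \<delta>: "\<delta> > 0" and u0: "u 0 = x0"
    and u: "\<And>t. t \<in> {0..\<delta>} \<Longrightarrow> (u has_vector_derivative F (?pr (u t))) (at t within {0..\<delta>})"
    by blast
  have "continuous (at 0 within {0..\<delta>}) u"
    using u[of 0] \<delta> by (auto intro: has_vector_derivative_continuous)
  then obtain r where r: "r > 0" "\<And>t. t \<in> {0..\<delta>} \<Longrightarrow> dist t 0 < r \<Longrightarrow> dist (u t) x0 < 1"
    unfolding continuous_within_eps_delta u0 by (metis zero_less_one)
  \<comment> \<open>Before time \<open>d\<close> the curve remains in the ball, where the projection
    is the identity, so it solves the original equation.\<close>
  define d where "d = min \<delta> r"
  have "d > 0" using r \<delta> by (simp add: d_def)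
  have "(u has_vector_derivative F (u t)) (at t within {0..<d})" if t: "t \<in> {0..<d}" for t
  proof -
    have "?pr (u t) = u t"
      using r(2)[of t] t by (intro closest_point_self) (auto simp: d_def dist_commute)
    then have "(u has_vector_derivative F (u t)) (at t within {0..\<delta>})"
      using u[of t] t by (simp add: d_def)
    then show ?thesis
      by (rule has_vector_derivative_within_subset) (auto simp: d_def)
  qed
  then have "solves_ivp F x0 (ereal d) u"
    unfolding solves_ivp_def ereal_interval_eq_atLeastLessThan using \<open>d > 0\<close> u0 by auto
  then show ?thesis by blast
qed

lemma solves_ivp_derivative:
  assumes "solves_ivp F x0 T \<zeta>" "0 \<le> a" "ereal b < T" "t \<in> {a..b}"
  shows "(\<zeta> has_vector_derivative F (\<zeta> t)) (at t within {a..b})"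
proof -
  have "ereal s < T" if "s \<le> b" for s using that assms(3) by (meson ereal_less_eq(3) le_less_trans)
  then have "{a..b} \<subseteq> {s. 0 \<le> s \<and> ereal s < T}" using assms(2) by auto
  moreover have "(\<zeta> has_vector_derivative F (\<zeta> t)) (at t within {s. 0 \<le> s \<and> ereal s < T})"
    using assms calculation unfolding solves_ivp_def by auto
  ultimately show ?thesis using has_vector_derivative_within_subset by blast
qed

lemma solves_ivp_unique:
  assumes "\<And>R. \<exists>L. L-lipschitz_on (cball 0 R) F"
    and "solves_ivp F x0 T u" "solves_ivp F x0 T' v" "0 \<le> t" "ereal t < T" "ereal t < T'"
  shows "u t = v t"
proof (rule ode_solution_unique[OF assms(1) \<open>0 \<le> t\<close>])
  show "u 0 = v 0" using assms(2,3) by (simp add: solves_ivp_def)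
qed (rule solves_ivp_derivative[OF assms(2)] solves_ivp_derivative[OF assms(3)]; use assms in auto)+

text \<open>The maximal time is the supremum of all existence times. Uniqueness makes solutions
  agree on common domains, so they glue.\<close>

lemma ex_maximal_solution:
  fixes F :: "real ^ 'n::finite \<Rightarrow> real ^ 'n"
  assumes lips: "\<And>a R. \<exists>L. L-lipschitz_on (cball a R) F"
  shows "\<exists>T \<zeta>. maximal_solution F x0 T \<zeta>"
proof -
  define S where "S = {T. \<exists>\<zeta>. solves_ivp F x0 T \<zeta>}"
  \<comment> \<open>For each time, some solution living beyond it is chosen; \<open>z\<close> reads
    off the diagonal, and by uniqueness the choice does not affect the value.\<close>
  define sol where "sol t = (SOME \<zeta>. \<exists>T. solves_ivp F x0 T \<zeta> \<and> ereal t < T)" for t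
  define z where "z t = sol t t" for t
  have z: "z t = \<zeta> t" if \<zeta>: "solves_ivp F x0 T \<zeta>" "0 \<le> t" "ereal t < T" for T \<zeta> t
  proof -
    have "\<exists>T. solves_ivp F x0 T (sol t) \<and> ereal t < T"
      unfolding sol_def by (rule someI[of _ \<zeta>]) (use \<zeta> in blast)
    then show ?thesis unfolding z_def using solves_ivp_unique[OF lips] \<zeta> by blast
  qed
  obtain T0 \<zeta>0 where T0: "solves_ivp F x0 T0 \<zeta>0"
    using ex_solves_ivp lips by metis
  have "(z has_vector_derivative F (z t)) (at t within {s. 0 \<le> s \<and> ereal s < Sup S})"
    if t: "0 \<le> t" "ereal t < Sup S" for t
  proof -
    obtain T where T: "T \<in> S" "ereal t < T" using t(2) by (auto simp: less_Sup_iff)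
    then obtain \<zeta> where \<zeta>: "solves_ivp F x0 T \<zeta>" by (auto simp: S_def)
    have "T \<le> Sup S" using T(1) by (rule Sup_upper)
    have "(\<zeta> has_vector_derivative F (\<zeta> t)) (at t within {s. 0 \<le> s \<and> ereal s < T})"
      using \<zeta> t T by (auto simp: solves_ivp_def)
    then have "(z has_vector_derivative F (z t)) (at t within {s. 0 \<le> s \<and> ereal s < T})"
      unfolding z[OF \<zeta> t(1) T(2)]
      by (rule has_vector_derivative_transform[rotated 2]) (use t T z[OF \<zeta>] in auto)
    \<comment> \<open>The two domains agree on an open neighbourhood of \<open>t\<close>, so
      derivatives within them coincide.\<close>
    moreover have "at t within {s. 0 \<le> s \<and> ereal s < T} = at t within {s. 0 \<le> s \<and> ereal s < Sup S}"
    proof (rule at_within_nhd[where S = "{s. ereal s < T}"])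
      show "open {s. ereal s < T}" by (intro open_Collect_less continuous_intros continuous_on_ereal)
    qed (use T \<open>T \<le> Sup S\<close> in auto)
    ultimately show ?thesis by simp
  qed
  moreover have "0 < Sup S"
    using T0 by (auto simp: less_Sup_iff S_def solves_ivp_def)
  moreover have "z 0 = x0" using z[OF T0, of 0] T0 by (auto simp: solves_ivp_def zero_ereal_def)
  ultimately have "solves_ivp F x0 (Sup S) z" by (simp add: solves_ivp_def)
  then have "maximal_solution F x0 (Sup S) z"
    by (auto simp: maximal_solution_def S_def intro: Sup_upper)
  then show ?thesis by blast
qed

section \<open>Barrier certificates\<close>

text \<open>By the chain rule the derivative pairs the gradient of \<open>lie f k B\<close> with the
  velocity, which is the defining sum of the next Lie derivative.\<close>

lemma lie_has_derivative_along_solution: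
  assumes "(\<zeta> has_vector_derivative vfield f (\<zeta> t)) (at t within S)"
  shows "((\<lambda>t. peval (lie f k B) (\<zeta> t)) has_real_derivative peval (lie f (Suc k) B) (\<zeta> t))
    (at t within S)"
proof -
  have "((\<lambda>t. peval (lie f k B) (\<zeta> t)) has_derivative
      (\<lambda>h. \<Sum>i\<in>UNIV. peval (pderiv_var i (lie f k B)) (\<zeta> t) * (h *\<^sub>R vfield f (\<zeta> t)) $ i))
      (at t within S)"
    using assms unfolding has_vector_derivative_def
    by (rule has_derivative_compose[OF _ has_derivative_peval])
  then show ?thesis
    unfolding has_field_derivative_def
    by (rule has_derivative_eq_rhs)
      (simp add: fun_eq_iff peval_sum peval_mult pgrad_def vfield_def sum_distrib_left mult_ac)
qed

section \<open>Propagation of zeros along solutions\<close>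

text \<open>Polynomial cofactors are bounded on \<open>K\<close>. Induction over the span adds one
  cofactor bound \<open>M\<close> at a time, so no explicit representation of \<open>p\<close> is
  carried along.\<close>

lemma ideal_gen_peval_bound:
  assumes "p \<in> ideal_gen (q ` {0..N::nat})" and "compact K"
  shows "\<exists>C. \<forall>x\<in>K. \<bar>peval p x\<bar> \<le> C * (\<Sum>j\<le>N. \<bar>peval (q j) x\<bar>)"
  using assms(1)
proof (induction rule: ideal_gen_induct [consumes 1, case_names base step])
  case base
  then show ?case by (intro exI[of _ 0]) simp
next
  case (step c b y)
  then obtain j where j: "j \<le> N" "b = q j" by auto
  obtain C where C: "\<And>x. x \<in> K \<Longrightarrow> \<bar>peval y x\<bar> \<le> C * (\<Sum>j\<le>N. \<bar>peval (q j) x\<bar>)"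
    using step by blast
  have "bounded (peval c ` K)"
    using \<open>compact K\<close> by (intro compact_imp_bounded compact_continuous_image continuous_on_peval)
  then obtain M where M: "\<And>x. x \<in> K \<Longrightarrow> \<bar>peval c x\<bar> \<le> M" by (auto simp: bounded_iff)
  have "\<bar>peval (c * b + y) x\<bar> \<le> (M + C) * (\<Sum>j\<le>N. \<bar>peval (q j) x\<bar>)" if x: "x \<in> K" for x
  proof -
    have "\<bar>peval b x\<bar> \<le> (\<Sum>j\<le>N. \<bar>peval (q j) x\<bar>)"
      unfolding j(2) using j(1) by (intro member_le_sum) auto
    then have "\<bar>peval c x\<bar> * \<bar>peval b x\<bar> \<le> M * (\<Sum>j\<le>N. \<bar>peval (q j) x\<bar>)"
      using M[OF x] by (intro mult_mono) auto
    moreover have "\<bar>peval (c * b + y) x\<bar> \<le> \<bar>peval c x\<bar> * \<bar>peval b x\<bar> + \<bar>peval y x\<bar>"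
      by (simp add: peval_add peval_mult flip: abs_mult)
    ultimately show ?thesis using C[OF x] by (simp add: distrib_right)
  qed
  then show ?case by blast
qed

text \<open>Ideal membership closes the system of derivatives: up to a constant, each is bounded by
  the sizes of the first \<open>N + 1\<close> Lie derivatives. A system starting at 0 then stays
  there.\<close>

lemma barrier_vanishes_along_solution:
  fixes f :: "'n::finite rpoly ^ 'n" and B :: "'n rpoly"
  assumes mem: "lie f (Suc N) B \<in> ideal_gen ((\<lambda>j. lie f j B) ` {0..N})"
    and "a \<le> b"
    and \<zeta>: "\<And>t. t \<in> {a..b} \<Longrightarrow> (\<zeta> has_vector_derivative vfield f (\<zeta> t)) (at t within {a..b})"
    and zero: "\<And>j. j \<le> N \<Longrightarrow> peval (lie f j B) (\<zeta> a) = 0"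
  shows "peval B (\<zeta> b) = 0"
proof -
  define g where "g j t = peval (lie f j B) (\<zeta> t)" for j t
  define A where "A t = (\<Sum>j\<le>N. \<bar>g j t\<bar>)" for t
  have "compact (\<zeta> ` {a..b})"
    using \<zeta> by (intro compact_continuous_image continuous_on_vector_derivative) auto
  from ideal_gen_peval_bound[OF mem this]
  obtain C where C: "\<And>t. t \<in> {a..b} \<Longrightarrow> \<bar>g (Suc N) t\<bar> \<le> C * A t"
    unfolding g_def A_def by blast
  have A_nonneg: "A t \<ge> 0" for t unfolding A_def by (simp add: sum_nonneg)
  have g_le: "\<bar>g j t\<bar> \<le> A t" if "j \<le> N" for j t
    unfolding A_def using that by (intro member_le_sum) auto
  \<comment> \<open>For \<open>j < N\<close> the next function is itself a summand of
    \<open>A\<close>; for \<open>j = N\<close> the ideal bound applies. The factor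
    \<open>1 + \<bar>C\<bar>\<close> covers both cases.\<close>
  have g_Suc_le: "\<bar>g (Suc j) t\<bar> \<le> (1 + \<bar>C\<bar>) * A t" if "j \<le> N" "t \<in> {a..b}" for j t
  proof (cases "j = N")
    case True
    have "C * A t \<le> (1 + \<bar>C\<bar>) * A t" using A_nonneg[of t] by (intro mult_right_mono) auto
    then show ?thesis using C[OF that(2)] True by simp
  next
    case False
    have "1 * A t \<le> (1 + \<bar>C\<bar>) * A t" using A_nonneg[of t] by (intro mult_right_mono) auto
    then show ?thesis using g_le[of "Suc j" t] False that(1) by simp
  qed
  have "(\<Sum>j\<le>N. (g j b)\<^sup>2) \<le> 0"
  \<comment> \<open>One factor \<open>Suc N\<close> in the constant counts the summands; the other
    comes from Cauchy-Schwarz, bounding the square of \<open>A\<close> by \<open>Suc N\<close> times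
    the sum of squares.\<close>
  proof (rule gronwall_nonpos[OF \<open>a \<le> b\<close>, where h = "\<lambda>t. \<Sum>j\<le>N. (g j t)\<^sup>2"
        and h' = "\<lambda>t. \<Sum>j\<le>N. 2 * g j t * g (Suc j) t"
        and C = "2 * (1 + \<bar>C\<bar>) * real (Suc N) * real (Suc N)"])
    fix t assume t: "a \<le> t" "t \<le> b"
    have g_deriv: "(g j has_real_derivative g (Suc j) t) (at t within {a..b})" for j
      unfolding g_def[abs_def] using \<zeta> t by (intro lie_has_derivative_along_solution) auto
    show "((\<lambda>t. \<Sum>j\<le>N. (g j t)\<^sup>2) has_real_derivative (\<Sum>j\<le>N. 2 * g j t * g (Suc j) t))
        (at t within {a..b})"
      by (auto intro!: derivative_eq_intros g_deriv sum.cong)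
    have "2 * g j t * g (Suc j) t \<le> 2 * (1 + \<bar>C\<bar>) * (A t)\<^sup>2" if j: "j \<le> N" for j
    proof -
      have "g j t * g (Suc j) t \<le> \<bar>g j t\<bar> * \<bar>g (Suc j) t\<bar>" by (simp flip: abs_mult)
      also have "\<dots> \<le> A t * ((1 + \<bar>C\<bar>) * A t)"
        using g_le[OF j] g_Suc_le[OF j, of t] t A_nonneg[of t] by (intro mult_mono) auto
      finally show ?thesis by (simp add: power2_eq_square algebra_simps)
    qed
    then have "(\<Sum>j\<le>N. 2 * g j t * g (Suc j) t) \<le> (\<Sum>j\<le>N. 2 * (1 + \<bar>C\<bar>) * (A t)\<^sup>2)"
      by (intro sum_mono) auto
    also have "\<dots> = 2 * (1 + \<bar>C\<bar>) * real (Suc N) * (A t)\<^sup>2" by simp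
    also have "\<dots> \<le> 2 * (1 + \<bar>C\<bar>) * real (Suc N) * ((\<Sum>j\<le>N. (g j t)\<^sup>2) * real (Suc N))"
      using sum_squared_le_sum_of_squares[of "\<lambda>j. \<bar>g j t\<bar>" "{..N}"]
      by (intro mult_left_mono) (auto simp: A_def)
    finally show "(\<Sum>j\<le>N. 2 * g j t * g (Suc j) t) \<le>
        2 * (1 + \<bar>C\<bar>) * real (Suc N) * real (Suc N) * (\<Sum>j\<le>N. (g j t)\<^sup>2)"
      by (simp only: mult_ac)
  next
    show "(\<Sum>j\<le>N. (g j a)\<^sup>2) \<le> 0" using zero by (simp add: g_def)
  qed
  moreover have "(g 0 b)\<^sup>2 \<le> (\<Sum>j\<le>N. (g j b)\<^sup>2)" by (intro member_le_sum) auto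
  ultimately have "(g 0 b)\<^sup>2 \<le> 0" by linarith
  then show ?thesis by (simp add: g_def)
qed

section \<open>The two implications\<close>

text \<open>If a solution is outside at \<open>t1\<close>, let \<open>s\<close> be the last earlier
  time with \<open>B\<close> nonpositive. There \<open>B\<close> vanishes, and it must either remain
  zero or turn negative right after \<open>s\<close>; both contradict the choice of
  \<open>s\<close>.\<close>

lemma barrier_certificate_imp_inductive_invariant:
  fixes f :: "'n::finite rpoly ^ 'n" and B :: "'n rpoly"
  assumes cert: "invariant_barrier_certificate f X0 Xu B"
  shows "inductive_invariant (vfield f) {x. peval B x \<le> 0}"
  unfolding inductive_invariant_def
proof (intro ballI allI impI, rule ccontr)
  fix x0 T \<zeta> t1
  assume x0: "x0 \<in> {x. peval B x \<le> 0}" and max: "maximal_solution (vfield f) x0 T \<zeta>"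
    and t1: "0 \<le> t1 \<and> ereal t1 < T" and t1_out: "\<zeta> t1 \<notin> {x. peval B x \<le> 0}"
  have sol: "solves_ivp (vfield f) x0 T \<zeta>" using max by (simp add: maximal_solution_def)
  define N where "N = completeness_threshold B f"
  define g where "g j t = peval (lie f j B) (\<zeta> t)" for j t
  have g_deriv: "(g j has_real_derivative g (Suc j) t) (at t within {a..t1})"
    if "0 \<le> a" "t \<in> {a..t1}" for j a t
    unfolding g_def[abs_def]
    using solves_ivp_derivative[OF sol that(1) _ that(2)] t1
    by (intro lie_has_derivative_along_solution) auto
  have cont: "continuous_on {0..t1} (g 0)"
    using g_deriv[of 0] by (intro DERIV_continuous_on) auto
  define Z where "Z = {t\<in>{0..t1}. g 0 t \<le> 0}"
  have "compact Z" "0 \<in> Z"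
    using continuous_closed_preimage[OF cont, of "{..0}"] x0 t1 sol
    by (auto simp: Z_def compact_eq_bounded_closed vimage_def Int_def g_def solves_ivp_def
        intro: bounded_subset[OF bounded_closed_interval])
  then obtain s where s: "s \<in> Z" and s_max: "\<And>t. t \<in> Z \<Longrightarrow> t \<le> s"
    using compact_attains_sup[of Z] by blast
  have pos: "g 0 t > 0" if "s < t" "t \<le> t1" for t
    using s_max[of t] s that by (force simp: Z_def)
  have "g 0 t1 > 0" using t1_out by (simp add: g_def)
  then have s_bounds: "0 \<le> s" "s < t1" using s by (auto simp: Z_def intro: le_neq_trans)
  have "g 0 s = 0"
  proof -
    \<comment> \<open>The intermediate value theorem gives a zero in \<open>[s, t1]\<close>, and
      positivity after \<open>s\<close> places it at \<open>s\<close>.\<close>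
    have "continuous_on {s..t1} (g 0)" by (rule continuous_on_subset[OF cont]) (use s_bounds in auto)
    then obtain r where "s \<le> r" "r \<le> t1" "g 0 r = 0"
      using IVT'[of "g 0" s 0 t1] s \<open>g 0 t1 > 0\<close> s_bounds by (auto simp: Z_def)
    then show ?thesis using pos[of r] by (cases "r = s") auto
  qed
  show False
  proof (cases "\<forall>j\<le>N. g j s = 0")
    case True
    have "peval B (\<zeta> t1) = 0"
    proof (rule barrier_vanishes_along_solution[where a = s])
      show "lie f (Suc N) B \<in> ideal_gen ((\<lambda>j. lie f j B) ` {0..N})"
        unfolding N_def by (rule lie_completeness_threshold)
    qed (use True s_bounds t1 solves_ivp_derivative[OF sol] in \<open>auto simp: g_def\<close>)
    then show False using \<open>g 0 t1 > 0\<close> by (simp add: g_def)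
  next
    case False
    define k where "k = (LEAST j. g j s \<noteq> 0)"
    obtain j where "j \<le> N" "g j s \<noteq> 0" using False by blast
    have k: "g k s \<noteq> 0" "k \<le> N" "\<And>j. j < k \<Longrightarrow> g j s = 0"
    proof -
      show "g k s \<noteq> 0" unfolding k_def by (rule LeastI[of _ j]) fact
      show "k \<le> N"
        using Least_le[of "\<lambda>j. g j s \<noteq> 0", OF \<open>g j s \<noteq> 0\<close>] \<open>j \<le> N\<close> unfolding k_def by linarith
      show "g j s = 0" if "j < k" for j
        using not_less_Least[OF that[unfolded k_def]] by blast
    qed
    \<comment> \<open>Now \<open>1 \<le> k \<le> N\<close>, so consecution applies at order
      \<open>k\<close>, and \<open>{0..k - 1}\<close> is exactly the set of lower orders.\<close>
    have "k \<ge> 1" using k(1) \<open>g 0 s = 0\<close> by (cases k) auto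
    then have "g k s \<le> 0"
      using cert k(2,3) unfolding invariant_barrier_certificate_def N_def g_def by auto
    then have "- g k s > 0" using k(1) by simp
    \<comment> \<open>The sign lemma is applied to the negated family, giving negative
      \<open>g 0\<close> just after \<open>s\<close>.\<close>
    have "\<exists>d>s. d \<le> t1 \<and> (\<forall>t. s < t \<and> t \<le> d \<longrightarrow> - g 0 t > 0)"
    proof (rule pos_right_of_first_nonzero_derivative[where g = "\<lambda>j t. - g j t" and k = k])
      show "((\<lambda>t. - g j t) has_real_derivative - g (Suc j) t) (at t within {s..t1})"
        if "s \<le> t" "t \<le> t1" for j t
        using g_deriv[of s t j] that s_bounds by (intro DERIV_minus) auto
    qed (use k s_bounds \<open>- g k s > 0\<close> in auto)
    then show False using pos by (metis less_le_not_le neg_0_less_iff_less order_refl)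
  qed
qed

text \<open>A positive first nonzero Lie derivative would make \<open>B\<close> positive right after
  time 0 on the solution from \<open>x\<close>, although \<open>x\<close> lies on the zero set of
  \<open>B\<close>.\<close>

lemma inductive_invariant_imp_lie_nonpos:
  fixes f :: "'n::finite rpoly ^ 'n" and B :: "'n rpoly"
  assumes inv: "inductive_invariant (vfield f) {x. peval B x \<le> 0}"
    and "i \<ge> 1" and zero: "\<And>j. j < i \<Longrightarrow> peval (lie f j B) x = 0"
  shows "peval (lie f i B) x \<le> 0"
proof (rule ccontr)
  assume lie_pos: "\<not> ?thesis"
  \<comment> \<open>Invariance speaks only about maximal solutions, so one through \<open>x\<close>
    must be exhibited.\<close>
  obtain T \<zeta> where max: "maximal_solution (vfield f) x T \<zeta>"
    using ex_maximal_solution[OF vfield_lipschitz_on_cball] by blast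
  then have sol: "solves_ivp (vfield f) x T \<zeta>" by (simp add: maximal_solution_def)
  then have \<zeta>0: "\<zeta> 0 = x" and "0 < T" by (auto simp: solves_ivp_def)
  then obtain e where e: "0 < e" "ereal e < T"
    using ereal_dense2[of 0 T] by auto
  have "\<exists>d>0. d \<le> e \<and> (\<forall>t. 0 < t \<and> t \<le> d \<longrightarrow> peval (lie f 0 B) (\<zeta> t) > 0)"
  proof (rule pos_right_of_first_nonzero_derivative[where g = "\<lambda>j t. peval (lie f j B) (\<zeta> t)" and k = i])
    show "((\<lambda>t. peval (lie f j B) (\<zeta> t)) has_real_derivative peval (lie f (Suc j) B) (\<zeta> t))
        (at t within {0..e})" if "0 \<le> t" "t \<le> e" for j t
      using solves_ivp_derivative[OF sol _ e(2)] that by (intro lie_has_derivative_along_solution) auto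
  qed (use lie_pos zero \<zeta>0 e in auto)
  then obtain d where d: "d > 0" "d \<le> e" "peval B (\<zeta> d) > 0" by auto
  have "ereal d < T" using d(2) e(2) by (meson ereal_less_eq(3) le_less_trans)
  moreover have "x \<in> {x. peval B x \<le> 0}" using zero[of 0] \<open>i \<ge> 1\<close> by simp
  ultimately have "\<zeta> d \<in> {x. peval B x \<le> 0}"
    using inv max d(1) unfolding inductive_invariant_def by (meson less_imp_le)
  then show False using d(3) by simp
qed

theorem theorem4:
  fixes f :: "'n::finite rpoly ^ 'n"
    and X0 Xu \<Psi> :: "(real ^ 'n) set"
    and B :: "'n rpoly"
  assumes \<Psi>_def: "\<Psi> = {x. peval B x \<le> 0}"
  shows "(invariant_barrier_certificate f X0 Xu B \<longrightarrow> inductive_invariant (vfield f) \<Psi>) \<and>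
         (inductive_invariant (vfield f) \<Psi> \<and> X0 \<subseteq> \<Psi> \<and> \<Psi> \<inter> Xu = {} \<longrightarrow>
            invariant_barrier_certificate f X0 Xu B)"
proof (intro conjI impI)
  assume "invariant_barrier_certificate f X0 Xu B"
  then show "inductive_invariant (vfield f) \<Psi>"
    unfolding \<Psi>_def by (rule barrier_certificate_imp_inductive_invariant)
next
  assume inv: "inductive_invariant (vfield f) \<Psi> \<and> X0 \<subseteq> \<Psi> \<and> \<Psi> \<inter> Xu = {}"
  \<comment> \<open>The bound is derived at every positive order, hence at all orders up to the
    threshold.\<close>
  have "peval (lie f i B) x \<le> 0"
    if "i \<ge> 1" "\<forall>j\<in>{0..i - 1}. peval (lie f j B) x = 0" for i x
    using inv that unfolding \<Psi>_def by (intro inductive_invariant_imp_lie_nonpos) auto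
  moreover have "peval B x > 0" if "x \<in> Xu" for x
    using inv that unfolding \<Psi>_def by force
  ultimately show "invariant_barrier_certificate f X0 Xu B"
    using inv unfolding invariant_barrier_certificate_def \<Psi>_def by auto
qed

end
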